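(* Let $d\ge 2$, let $g\in C(S^{d-1})$ be a real-valued continuous function on the unit sphere, and let $c=\gamma_d\int_{S^{d-1}} g(\theta)\,d\theta$, where $\gamma_d=\frac{1}{\sqrt{\pi}}\frac{\Gamma((d+1)/2)}{\Gamma(d/2)}$. Let $u\in C^2(\mathbf{R}^d)$ be the solution of $$\frac12\sum_{i,j=1}^d(\delta_{ij}+x_ix_j)\frac{\partial^2u}{\partial x_i\partial x_j}(x)=c,\qquad x\in\mathbf{R}^d,$$ with $u(0)=0$ and $$\lim_{r\to\infty}\sup_{\theta\in S^{d-1}}\left|\frac{u(r\theta)}{r}-g(\theta)\right|=0.$$ Then $u$ is convex on $\mathbf{R}^d$ if and only if the function $v\in C(\mathbf{R}^d)$ given by $v(x)=|x|\,g(x/|x|)$ for $x\ne0$ and $v(0)=0$ is convex on $\mathbf{R}^d$.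
   Context: $S^{d-1}=\{x\in\mathbf{R}^d:|x|=1\}$, and $d\theta$ denotes Lebesgue (surface) measure on $S^{d-1}$ normalised so that $\int_{S^{d-1}}1\,d\theta=1$. $\delta_{ij}$ is the Kronecker delta. For each $g\in C(S^{d-1})$ there is exactly one function $u$ with the listed properties. *)

theory Defs
  imports "HOL-Analysis.Analysis"
begin

text \<open>The normalised surface measure of a Borel set \<open>E\<close> in the unit sphere is the share of the
  unit ball filled by the cone \<open>{t *\<^sub>R \<theta> | 0 < t < 1, \<theta> \<in> E}\<close>. The radial projection \<open>sgn\<close> sends
  the origin to \<open>0\<close>, which lies off the sphere and is dropped by the restriction. See
  \<open>emeasure_sphere_measure\<close> and \<open>emeasure_sphere_measure_total\<close> below. The measure lives on
  the sphere only, so integrands need not be measurable off it.\<close>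

definition sphere_measure :: "(real ^ 'n) measure" where
  "sphere_measure = restrict_space (distr (uniform_measure lborel (ball 0 1)) borel sgn) (sphere 0 1)"

definition gamma_const :: "nat \<Rightarrow> real" where
  "gamma_const d = 1 / sqrt pi * (Gamma ((real d + 1) / 2) / Gamma (real d / 2))"

definition partial_deriv :: "'n \<Rightarrow> (real ^ 'n \<Rightarrow> real) \<Rightarrow> real ^ 'n \<Rightarrow> real" where
  "partial_deriv i f x = deriv (\<lambda>t. f (x + t *\<^sub>R axis i 1)) 0"

text \<open>The value of \<open>deriv\<close> is arbitrary where no derivative exists, so the regularity predicates
  ask for existence of the partial derivatives separately.\<close>

definition has_partial_derivs :: "(real ^ 'n \<Rightarrow> real) \<Rightarrow> bool" where
  "has_partial_derivs f \<longleftrightarrow> (\<forall>i x. (\<lambda>t. f (x + t *\<^sub>R axis i 1)) field_differentiable (at 0))"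

primrec C_k :: "nat \<Rightarrow> (real ^ 'n \<Rightarrow> real) \<Rightarrow> bool" where
  "C_k 0 f \<longleftrightarrow> continuous_on UNIV f"
| "C_k (Suc k) f \<longleftrightarrow>
     continuous_on UNIV f \<and> has_partial_derivs f \<and> (\<forall>i. C_k k (partial_deriv i f))"

definition homogeneous_extension :: "(real ^ 'n \<Rightarrow> real) \<Rightarrow> real ^ 'n \<Rightarrow> real" where
  "homogeneous_extension g x = (if x = 0 then 0 else norm x * g (x /\<^sub>R norm x))"

lemma space_sphere_measure [simp]: "space (sphere_measure :: (real ^ 'n) measure) = sphere 0 1"
  by (simp add: sphere_measure_def space_restrict_space)

lemma sets_sphere_measure [simp]:
  "sets (sphere_measure :: (real ^ 'n) measure) = sets (restrict_space borel (sphere 0 1))"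
  unfolding sphere_measure_def by (intro sets_restrict_space_cong) simp

lemma emeasure_sphere_measure_vimage:
  fixes E :: "(real ^ 'n) set"
  assumes "E \<in> sets borel" "E \<subseteq> sphere 0 1"
  shows "emeasure sphere_measure E =
    emeasure lborel (ball 0 1 \<inter> sgn -` E) / emeasure lborel (ball 0 1 :: (real ^ 'n) set)"
proof -
  have m: "(sgn :: real ^ 'n \<Rightarrow> _) \<in> borel_measurable borel"
    unfolding sgn_div_norm by measurable
  have "sgn -` E \<in> sets borel"
    using measurable_sets[OF m assms(1)] by simp
  moreover have "sgn \<in> measurable (uniform_measure lborel (ball 0 1)) (borel :: (real ^ 'n) measure)"
    using m by simp
  ultimately show ?thesis
    unfolding sphere_measure_def using assms
    by (subst emeasure_restrict_space)
       (auto simp: emeasure_distr emeasure_uniform_measure sphere_def dist_norm)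
qed

lemma cone_eq:
  fixes E :: "(real ^ 'n) set"
  assumes "E \<subseteq> sphere 0 1"
  shows "ball 0 1 \<inter> sgn -` E = {t *\<^sub>R \<theta> | t \<theta>. 0 < t \<and> t < 1 \<and> \<theta> \<in> E}"
proof (intro set_eqI iffI)
  fix x assume "x \<in> ball 0 1 \<inter> sgn -` E"
  then have "norm x < 1" "sgn x \<in> E" by auto
  moreover from this have "x \<noteq> 0" using assms by auto
  ultimately show "x \<in> {t *\<^sub>R \<theta> | t \<theta>. 0 < t \<and> t < 1 \<and> \<theta> \<in> E}"
    by (intro CollectI exI[of _ "norm x"] exI[of _ "sgn x"]) (auto simp: sgn_div_norm)
next
  fix x assume "x \<in> {t *\<^sub>R \<theta> | t \<theta>. 0 < t \<and> t < 1 \<and> \<theta> \<in> E}"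
  then obtain t \<theta> where x: "x = t *\<^sub>R \<theta>" "0 < t" "t < 1" "\<theta> \<in> E" by auto
  then have n: "norm \<theta> = 1" using assms by auto
  then have "sgn x = \<theta>" using x by (simp add: sgn_div_norm)
  then show "x \<in> ball 0 1 \<inter> sgn -` E" using x n by simp
qed

lemma emeasure_sphere_measure:
  fixes E :: "(real ^ 'n) set"
  assumes "E \<in> sets borel" "E \<subseteq> sphere 0 1"
  shows "emeasure sphere_measure E =
    emeasure lborel {t *\<^sub>R \<theta> | t \<theta>. 0 < t \<and> t < 1 \<and> \<theta> \<in> E} /
    emeasure lborel (ball 0 1 :: (real ^ 'n) set)"
  using emeasure_sphere_measure_vimage[OF assms] cone_eq[OF assms(2)] by simp

lemma emeasure_sphere_measure_total:
  "emeasure (sphere_measure :: (real ^ 'n) measure) (sphere 0 1) = 1"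
proof -
  let ?B = "ball 0 1 :: (real ^ 'n) set"
  have eq: "?B \<inter> sgn -` sphere 0 1 = ?B - {0}"
    by (auto simp: norm_sgn)
  have "emeasure lborel (?B - {0}) = emeasure lborel ?B - emeasure lborel {0 :: real ^ 'n}"
    by (rule emeasure_Diff) (auto simp: emeasure_lborel_singleton)
  then have "emeasure lborel (?B - {0}) = emeasure lborel ?B"
    by simp
  moreover have "emeasure lborel ?B \<noteq> 0"
    using unit_ball_vol_pos[of "real CARD('n)"] less_irrefl by (fastforce simp: emeasure_ball simp del: unit_ball_vol_pos)
  moreover have "emeasure lborel ?B \<noteq> \<infinity>"
    using emeasure_bounded_finite[of ?B] by simp
  ultimately show ?thesis
    using emeasure_sphere_measure_vimage[of "sphere 0 1 :: (real ^ 'n) set"] eq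
    by (simp add: ennreal_divide_self less_top)
qed

end

theory Submission
  imports Defs
begin

text \<open>Pass to the function \<open>F (x, z) = z * u (x / z)\<close> on the half-space \<open>z > 0\<close>. It is
  positively homogeneous of degree one, and the equation for \<open>u\<close> becomes
  \<open>\<Delta> F (x, z) = 2 * c / z\<close>. The growth condition says that \<open>F\<close> extends continuously to \<open>z = 0\<close>
  by the homogeneous extension \<open>v\<close> of \<open>g\<close>, so convexity of \<open>u\<close> passes to \<open>v\<close> by letting \<open>z\<close> tend
  to \<open>0\<close>. Conversely, let \<open>p, q \<ge> 0\<close> and \<open>p + q = 1\<close>. As the right-hand
  side depends on \<open>z\<close> only, the convexity defect
  \<open>W (x, z) = p * F (x + q k, z) + q * F (x - p k, z) - F (x, z)\<close> is harmonic. It is nonnegative at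
  \<open>z = 0\<close> if \<open>v\<close> is convex, and by homogeneity and uniform continuity of \<open>F\<close> it is \<open>o(R)\<close> on
  half-spheres of radius \<open>R\<close>. A maximum principle of Phragmen-Lindeloef type gives \<open>W \<ge> 0\<close>.\<close>

section \<open>Partial derivatives, the chain rule and a second derivative test\<close>

lemma partial_deriv_works:
  assumes "has_partial_derivs f"
  shows "((\<lambda>s. f (x + s *\<^sub>R axis i 1)) has_real_derivative partial_deriv i f (x + t *\<^sub>R axis i 1)) (at t)"
proof -
  let ?y = "x + t *\<^sub>R axis i 1"
  have "((\<lambda>s. f (?y + s *\<^sub>R axis i 1)) has_real_derivative partial_deriv i f ?y) (at 0)"
    using assms unfolding has_partial_derivs_def partial_deriv_def
    by (simp add: DERIV_deriv_iff_field_differentiable)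
  then have "((\<lambda>s. f (x + (s + t) *\<^sub>R axis i 1)) has_real_derivative partial_deriv i f ?y) (at 0)"
    by (simp add: algebra_simps)
  then show ?thesis
    using DERIV_at_within_shift[of "\<lambda>s. f (x + s *\<^sub>R axis i 1)" "partial_deriv i f ?y" t 0 UNIV]
    by (simp add: add.commute)
qed

text \<open>Mean value inequality along an axis, applied after subtracting the linear part
  \<open>t * l\<close>, so that closeness of the partial derivative to \<open>l\<close> becomes an
  error bound.\<close>

lemma partial_deriv_increment_bound:
  assumes "has_partial_derivs f"
    and "\<And>t. \<bar>t\<bar> \<le> \<bar>s\<bar> \<Longrightarrow> \<bar>partial_deriv i f (x + t *\<^sub>R axis i 1) - l\<bar> \<le> e"
  shows "\<bar>f (x + s *\<^sub>R axis i 1) - f x - s * l\<bar> \<le> e * \<bar>s\<bar>"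
proof -
  let ?\<phi> = "\<lambda>t. f (x + t *\<^sub>R axis i 1) - t * l"
  have "norm (?\<phi> s - ?\<phi> 0) \<le> e * norm (s - 0)"
  proof (rule field_differentiable_bound[where S = "closed_segment 0 s"
        and f' = "\<lambda>t. partial_deriv i f (x + t *\<^sub>R axis i 1) - l"])
    fix t assume t: "t \<in> closed_segment 0 s"
    show "(?\<phi> has_real_derivative partial_deriv i f (x + t *\<^sub>R axis i 1) - l)
        (at t within closed_segment 0 s)"
      by (auto intro!: derivative_eq_intros DERIV_subset[OF partial_deriv_works[OF assms(1)]])
    show "norm (partial_deriv i f (x + t *\<^sub>R axis i 1) - l) \<le> e"
      using t by (auto intro!: assms(2) simp: closed_segment_eq_real_ivl split: if_splits)
  qed auto
  then show ?thesis by (simp add: algebra_simps)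
qed

text \<open>The coordinates of the increment are switched on one at a time. Each switch moves along
  one axis, where continuity of that partial derivative at \<open>x\<close> controls the
  error.\<close>

lemma has_derivative_partial_derivs:
  fixes f :: "real ^ 'n \<Rightarrow> real"
  assumes f: "has_partial_derivs f"
    and cont: "\<And>i. continuous_on UNIV (partial_deriv i f)"
  shows "(f has_derivative (\<lambda>h. \<Sum>i\<in>UNIV. h $ i * partial_deriv i f x)) (at x)"
proof -
  \<comment> \<open>\<open>P S h\<close> keeps the coordinates of \<open>h\<close> in
    \<open>S\<close> and zeroes the others; the induction on \<open>S\<close> runs from
    \<open>x\<close> to \<open>x + h\<close>.\<close>
  define P :: "'n set \<Rightarrow> real ^ 'n \<Rightarrow> real ^ 'n"
    where "P S h = (\<chi> i. if i \<in> S then h $ i else 0)" for S h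
  have step: "\<exists>\<delta>>0. \<forall>h. norm h < \<delta> \<longrightarrow>
      \<bar>f (x + P S h) - f x - (\<Sum>i\<in>S. h $ i * partial_deriv i f x)\<bar> \<le> e * norm h"
    if "finite S" "e > 0" for S e
    using that
  proof (induction S arbitrary: e rule: finite_induct)
    case empty
    have "P {} h = 0" for h by (simp add: P_def vec_eq_iff)
    then show ?case using empty by (auto intro: exI[of _ 1])
  next
    case (insert j S)
    obtain \<delta>1 where \<delta>1: "\<delta>1 > 0" "\<And>h. norm h < \<delta>1 \<Longrightarrow>
        \<bar>f (x + P S h) - f x - (\<Sum>i\<in>S. h $ i * partial_deriv i f x)\<bar> \<le> e / 2 * norm h"
      using insert.IH[of "e / 2"] insert.prems by auto
    obtain \<delta>2 where \<delta>2: "\<delta>2 > 0" "\<And>y. dist y x < \<delta>2 \<Longrightarrow>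
        dist (partial_deriv j f y) (partial_deriv j f x) < e / 2"
      using cont[of j] insert.prems unfolding continuous_on_iff
      by (metis UNIV_I half_gt_zero)
    show ?case
    proof (intro exI conjI allI impI)
      show "min \<delta>1 \<delta>2 > 0" using \<delta>1 \<delta>2 by simp
      fix h :: "real ^ 'n" assume h: "norm h < min \<delta>1 \<delta>2"
      have Pj: "P (insert j S) h = P S h + (h $ j) *\<^sub>R axis j 1"
        using insert.hyps by (auto simp: P_def vec_eq_iff axis_def)
      have "\<bar>f (x + P S h + (h $ j) *\<^sub>R axis j 1) - f (x + P S h) - h $ j * partial_deriv j f x\<bar>
          \<le> e / 2 * \<bar>h $ j\<bar>"
      proof (rule partial_deriv_increment_bound[OF f])
        fix t assume t: "\<bar>t\<bar> \<le> \<bar>h $ j\<bar>"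
        \<comment> \<open>Since \<open>j\<close> is not in \<open>S\<close>, every coordinate of
          this vector is dominated by that of \<open>h\<close>, so the path stays in the ball where
          \<open>\<delta>2\<close> works.\<close>
        have "norm (P S h + t *\<^sub>R axis j 1) \<le> norm h"
          using insert.hyps t by (intro norm_le_componentwise_cart) (auto simp: P_def axis_def)
        then have "dist (x + P S h + t *\<^sub>R axis j 1) x < \<delta>2"
          using h by (simp add: dist_norm add.assoc)
        from \<delta>2(2)[OF this]
        show "\<bar>partial_deriv j f (x + P S h + t *\<^sub>R axis j 1) - partial_deriv j f x\<bar> \<le> e / 2"
          by (simp add: dist_real_def)
      qed
      also have "\<dots> \<le> e / 2 * norm h"
        using insert.prems by (intro mult_left_mono component_le_norm_cart) auto
      finally have "\<bar>f (x + P (insert j S) h) - f (x + P S h) - h $ j * partial_deriv j f x\<bar>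
          \<le> e / 2 * norm h"
        by (simp add: Pj add.assoc)
      moreover have "\<bar>f (x + P S h) - f x - (\<Sum>i\<in>S. h $ i * partial_deriv i f x)\<bar> \<le> e / 2 * norm h"
        using \<delta>1(2) h by simp
      moreover have "(\<Sum>i\<in>insert j S. h $ i * partial_deriv i f x) =
          h $ j * partial_deriv j f x + (\<Sum>i\<in>S. h $ i * partial_deriv i f x)"
        using insert.hyps by simp
      moreover have "e * norm h = e / 2 * norm h + e / 2 * norm h"
        by simp
      ultimately show "\<bar>f (x + P (insert j S) h) - f x - (\<Sum>i\<in>insert j S. h $ i * partial_deriv i f x)\<bar>
          \<le> e * norm h"
        by linarith
    qed
  qed
  have P: "P UNIV h = h" for h by (simp add: P_def vec_eq_iff)
  show ?thesis
    unfolding has_derivative_at_alt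
  proof (intro conjI allI impI)
    show "bounded_linear (\<lambda>h. \<Sum>i\<in>UNIV. h $ i * partial_deriv i f x)"
      by (intro bounded_linear_sum bounded_linear_mult_left[THEN bounded_linear_compose]
          bounded_linear_vec_nth)
    fix e :: real assume "e > 0"
    then obtain \<delta> where \<delta>: "\<delta> > 0" "\<And>h. norm h < \<delta> \<Longrightarrow>
        \<bar>f (x + h) - f x - (\<Sum>i\<in>UNIV. h $ i * partial_deriv i f x)\<bar> \<le> e * norm h"
      using step[of UNIV e] by (auto simp: P)
    show "\<exists>\<delta>>0. \<forall>y. norm (y - x) < \<delta> \<longrightarrow>
        norm (f y - f x - (\<Sum>i\<in>UNIV. (y - x) $ i * partial_deriv i f x)) \<le> e * norm (y - x)"
      using \<delta>(1) \<delta>(2)[of "y - x" for y] by (auto intro!: exI[of _ \<delta>])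
  qed
qed

lemma C_k_continuous: "C_k k f \<Longrightarrow> continuous_on UNIV f"
  by (cases k) auto

lemma C_k_partial_deriv_chain:
  assumes "C_k (Suc k) f" "(\<gamma> has_vector_derivative w) (at t)"
  shows "((\<lambda>s. f (\<gamma> s)) has_real_derivative (\<Sum>i\<in>UNIV. w $ i * partial_deriv i f (\<gamma> t))) (at t)"
proof -
  have "(f has_derivative (\<lambda>h. \<Sum>i\<in>UNIV. h $ i * partial_deriv i f (\<gamma> t))) (at (\<gamma> t))"
    using assms by (intro has_derivative_partial_derivs) (auto intro: C_k_continuous)
  from vector_derivative_diff_chain_within[OF assms(2) has_derivative_at_withinI[OF this]]
  show ?thesis
    by (simp add: has_real_derivative_iff_has_vector_derivative o_def)
qed

text \<open>If \<open>l\<close> were negative, \<open>f'\<close>, which vanishes at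
  \<open>a\<close>, would be negative just to the right of it, and the mean value theorem would
  produce a value below the minimum.\<close>

lemma second_derivative_nonneg_at_local_min:
  fixes f f' :: "real \<Rightarrow> real"
  assumes "\<delta> > 0" "\<And>t. \<bar>t - a\<bar> < \<delta> \<Longrightarrow> (f has_real_derivative f' t) (at t)"
    and f'': "(f' has_real_derivative l) (at a)"
    and min: "\<And>t. \<bar>t - a\<bar> < \<delta> \<Longrightarrow> f a \<le> f t"
  shows "l \<ge> 0"
proof (rule ccontr)
  assume "\<not> l \<ge> 0"
  have "f' a = 0"
    using DERIV_local_min[OF assms(2) assms(1), of a] min assms(1) by (auto simp: abs_minus_commute)
  obtain d where d: "d > 0" "\<And>h. h > 0 \<Longrightarrow> h < d \<Longrightarrow> f' (a + h) < f' a"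
    using DERIV_neg_dec_right[OF f''] \<open>\<not> l \<ge> 0\<close> by auto
  define h where "h = min d \<delta> / 2"
  have h: "h > 0" "h < d" "h < \<delta>" using d(1) assms(1) by (auto simp: h_def)
  obtain z where z: "a < z" "z < a + h" "f (a + h) - f a = (a + h - a) * f' z"
    using MVT2[of a "a + h" f f'] assms(2) h by auto
  have "f' z < 0" using d(2)[of "z - a"] z h \<open>f' a = 0\<close> by auto
  then have "h * f' z < 0" using h by (simp add: mult_pos_neg)
  then have "f (a + h) < f a" using z by simp
  then show False using min[of "a + h"] h by auto
qed


section \<open>The perspective of u and its second derivatives\<close>

text \<open>This is \<open>F\<close> on the closed half-space, with height \<open>snd X\<close>:
  height one carries \<open>u\<close> itself, height zero the boundary values
  \<open>v\<close>.\<close>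

definition conic_extension ::
  "(real ^ 'n \<Rightarrow> real) \<Rightarrow> (real ^ 'n \<Rightarrow> real) \<Rightarrow> (real ^ 'n) \<times> real \<Rightarrow> real" where
  "conic_extension v u X = (if snd X = 0 then v (fst X) else snd X * u (fst X /\<^sub>R snd X))"

lemma axis_nth_if: "axis i (1 :: real) $ j = (if j = i then 1 else 0)"
  by (simp add: axis_def)

text \<open>The factor \<open>z\<close> cancels the \<open>1 / z\<close> from the chain rule.
  General \<open>k\<close> allows a second application, to \<open>partial_deriv i u\<close>.\<close>

lemma perspective_deriv_axis:
  assumes "C_k (Suc k) u" "z > 0"
  shows "((\<lambda>t. z * u ((a + t *\<^sub>R axis i 1) /\<^sub>R z)) has_real_derivative
      partial_deriv i u ((a + t *\<^sub>R axis i 1) /\<^sub>R z)) (at t)"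
proof -
  have "((\<lambda>t. (a + t *\<^sub>R axis i 1) /\<^sub>R z) has_vector_derivative axis i 1 /\<^sub>R z) (at t)"
    by (auto intro!: derivative_eq_intros)
  from C_k_partial_deriv_chain[OF assms(1) this]
  have "((\<lambda>t. u ((a + t *\<^sub>R axis i 1) /\<^sub>R z)) has_real_derivative
      partial_deriv i u ((a + t *\<^sub>R axis i 1) /\<^sub>R z) / z) (at t)"
    by (simp add: axis_nth_if if_distrib if_distribR divide_inverse mult.commute cong: if_cong)
  from DERIV_cmult[OF this, of z] show ?thesis
    using assms(2) by simp
qed

text \<open>The curve \<open>a / s\<close> has velocity \<open>- a / s^2\<close>. One factor
  \<open>1 / s\<close> stays with each coordinate of \<open>a\<close>, so that the coordinates of
  the point \<open>a / s\<close> appear as in the differential equation.\<close>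

lemma deriv_along_ray:
  assumes "C_k (Suc k) f" "s > 0"
  shows "((\<lambda>s. f (a /\<^sub>R s)) has_real_derivative
      - (\<Sum>j\<in>UNIV. a $ j / s * partial_deriv j f (a /\<^sub>R s)) / s) (at s)"
proof -
  have "((\<lambda>s. a /\<^sub>R s) has_vector_derivative - (a /\<^sub>R s\<^sup>2)) (at s)"
    using assms(2) by (auto intro!: derivative_eq_intros simp: power2_eq_square)
  from C_k_partial_deriv_chain[OF assms(1) this] show ?thesis
    using assms(2) by (simp add: sum_negf sum_divide_distrib power2_eq_square field_simps)
qed

lemma perspective_deriv_height:
  assumes "C_k (Suc k) u" "s > 0"
  shows "((\<lambda>s. s * u (a /\<^sub>R s)) has_real_derivative
      u (a /\<^sub>R s) - (\<Sum>j\<in>UNIV. a $ j / s * partial_deriv j u (a /\<^sub>R s))) (at s)"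
  using deriv_along_ray[OF assms] assms(2) by (auto intro!: derivative_eq_intros)

text \<open>With \<open>y = a / s\<close>, the first height derivative is \<open>u(y)\<close> minus
  the radial term. Differentiating again, the first-order terms cancel and the Hessian form in the
  direction \<open>y\<close>, divided by \<open>s\<close>, remains.\<close>

lemma perspective_deriv2_height:
  assumes "C_k 2 u" "s > 0"
  shows "((\<lambda>s. u (a /\<^sub>R s) - (\<Sum>j\<in>UNIV. a $ j / s * partial_deriv j u (a /\<^sub>R s))) has_real_derivative
      (\<Sum>j\<in>UNIV. a $ j / s *
        (\<Sum>i\<in>UNIV. a $ i / s * partial_deriv i (partial_deriv j u) (a /\<^sub>R s))) / s) (at s)"
proof -
  have u1: "C_k (Suc 1) u" and u2: "C_k (Suc 0) (partial_deriv j u)" for j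
    using assms(1) by (simp_all add: numeral_2_eq_2)
  define S where
    "S j = (\<Sum>i\<in>UNIV. a $ i / s * partial_deriv i (partial_deriv j u) (a /\<^sub>R s))" for j
  let ?P = "\<lambda>j. partial_deriv j u (a /\<^sub>R s)"
  have P: "((\<lambda>s. partial_deriv j u (a /\<^sub>R s)) has_real_derivative - S j / s) (at s)" for j
    unfolding S_def by (rule deriv_along_ray[OF u2 assms(2)])
  have "((\<lambda>s. a $ j / s * partial_deriv j u (a /\<^sub>R s)) has_real_derivative
      - (a $ j / s * ?P j) / s - a $ j / s * S j / s) (at s)" for j
  proof -
    have "((\<lambda>s. a $ j / s) has_real_derivative - (a $ j) / s / s) (at s)"
      using assms(2) by (auto intro!: derivative_eq_intros)
    from DERIV_mult[OF this P[of j]] show ?thesis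
      by (rule DERIV_cong) (simp add: field_simps)
  qed
  then have "((\<lambda>s. \<Sum>j\<in>UNIV. a $ j / s * partial_deriv j u (a /\<^sub>R s)) has_real_derivative
      (\<Sum>j\<in>UNIV. - (a $ j / s * ?P j) / s - a $ j / s * S j / s)) (at s)"
    by (intro DERIV_sum)
  moreover have "(\<Sum>j\<in>UNIV. - (a $ j / s * ?P j) / s - a $ j / s * S j / s)
      = - (\<Sum>j\<in>UNIV. a $ j / s * ?P j) / s - (\<Sum>j\<in>UNIV. a $ j / s * S j) / s"
    by (simp only: sum_subtractf sum_divide_distrib[symmetric] sum_negf)
  ultimately have "((\<lambda>s. \<Sum>j\<in>UNIV. a $ j / s * partial_deriv j u (a /\<^sub>R s)) has_real_derivative
      - (\<Sum>j\<in>UNIV. a $ j / s * ?P j) / s - (\<Sum>j\<in>UNIV. a $ j / s * S j) / s) (at s)"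
    by simp
  from DERIV_diff[OF deriv_along_ray[OF u1 assms(2), of a] this] show ?thesis
    by (simp add: S_def)
qed

text \<open>Splits the operator of the equation into the trace of the Hessian, coming from
  horizontal second derivatives of \<open>F\<close>, and the radial form, coming from the
  height.\<close>

lemma sum_delta_plus_rank_one:
  fixes y :: "real ^ 'n" and A :: "'n \<Rightarrow> 'n \<Rightarrow> real"
  shows "(\<Sum>i\<in>UNIV. \<Sum>j\<in>UNIV. ((if i = j then 1 else 0) + y $ i * y $ j) * A i j)
    = (\<Sum>i\<in>UNIV. A i i) + (\<Sum>j\<in>UNIV. y $ j * (\<Sum>i\<in>UNIV. y $ i * A i j))"
proof -
  have "(\<Sum>i\<in>UNIV. \<Sum>j\<in>UNIV. ((if i = j then 1 else 0) + y $ i * y $ j) * A i j)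
    = (\<Sum>i\<in>UNIV. A i i) + (\<Sum>i\<in>UNIV. \<Sum>j\<in>UNIV. y $ j * (y $ i * A i j))"
  proof -
    have "((if i = j then 1 else 0) + y $ i * y $ j) * A i j
        = (if i = j then A i j else 0) + y $ j * (y $ i * A i j)" for i j
      by (simp add: algebra_simps)
    then show ?thesis by (simp add: sum.distrib)
  qed
  also have "(\<Sum>i\<in>UNIV. \<Sum>j\<in>UNIV. y $ j * (y $ i * A i j))
    = (\<Sum>j\<in>UNIV. \<Sum>i\<in>UNIV. y $ j * (y $ i * A i j))"
    by (rule sum.swap)
  finally show ?thesis by (simp add: sum_distrib_left)
qed

section \<open>Behaviour at height zero\<close>

text \<open>Only height zero needs an argument. By homogeneity
  \<open>F (y, z) - v y = z * (u (y / z) - v (y / z))\<close>, which is at most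
  \<open>e * norm y + M * z\<close> in absolute value, and the slope \<open>e\<close> is
  arbitrary.\<close>

lemma continuous_on_conic_extension:
  fixes u v :: "real ^ 'n \<Rightarrow> real"
  assumes u: "continuous_on UNIV u" and v: "continuous_on UNIV v"
    and hom: "\<And>s x. s > 0 \<Longrightarrow> v (s *\<^sub>R x) = s * v x"
    and asymp: "\<And>e. e > 0 \<Longrightarrow> \<exists>M\<ge>0. \<forall>y. \<bar>u y - v y\<bar> \<le> e * norm y + M"
  shows "continuous_on {X. snd X \<ge> 0} (conic_extension v u)"
  unfolding continuous_on_eq_continuous_within
proof
  fix X :: "(real ^ 'n) \<times> real" assume "X \<in> {X. snd X \<ge> 0}"
  then consider "snd X > 0" | "snd X = 0" by fastforce
  then show "continuous (at X within {X. snd X \<ge> 0}) (conic_extension v u)"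
  proof cases
    case 1
    have op: "open {X :: (real ^ 'n) \<times> real. snd X > 0}"
      by (intro open_Collect_less continuous_intros)
    have "continuous_on {X. snd X > 0} (\<lambda>X. snd X * u (fst X /\<^sub>R snd X))"
      by (intro continuous_intros continuous_on_compose2[OF u]) auto
    then have "continuous_on {X. snd X > 0} (conic_extension v u)"
      by (rule continuous_on_eq) (auto simp: conic_extension_def)
    with op 1 have "isCont (conic_extension v u) X"
      by (simp add: continuous_on_eq_continuous_at del: split_paired_All)
    then show ?thesis
      by (rule continuous_at_imp_continuous_at_within)
  next
    case 2
    show ?thesis
      unfolding continuous_within_eps_delta
    proof (intro allI impI)
      fix e :: real assume "e > 0"
      \<comment> \<open>The slope is chosen so that \<open>e1 * norm y\<close> is at most
        \<open>e / 4\<close> for all \<open>y\<close> within distance one of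
        \<open>fst X\<close>.\<close>
      define e1 where "e1 = e / (4 * (norm (fst X) + 1))"
      have "norm (fst X) + 1 > 0" by (smt (verit) norm_ge_zero)
      with \<open>e > 0\<close> have e1: "e1 > 0" "e1 * (norm (fst X) + 1) = e / 4"
        by (auto simp: e1_def field_simps)
      obtain M where M: "M \<ge> 0" "\<And>y. \<bar>u y - v y\<bar> \<le> e1 * norm y + M"
        using asymp[OF e1(1)] by auto
      obtain \<delta> where \<delta>: "\<delta> > 0" "\<And>y. dist y (fst X) < \<delta> \<Longrightarrow> dist (v y) (v (fst X)) < e / 2"
        using v \<open>e > 0\<close> unfolding continuous_on_iff by (metis UNIV_I half_gt_zero)
      \<comment> \<open>The three bounds serve continuity of \<open>v\<close>, the bound on
        \<open>norm y\<close>, and \<open>M * z \<le> e / 4\<close>; \<open>M + 1\<close> avoids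
        division by zero.\<close>
      define \<delta>' where "\<delta>' = min (min \<delta> 1) (e / (4 * (M + 1)))"
      show "\<exists>d>0. \<forall>Y\<in>{X. snd X \<ge> 0}. dist Y X < d \<longrightarrow>
          dist (conic_extension v u Y) (conic_extension v u X) < e"
      proof (intro exI conjI ballI impI)
        show "\<delta>' > 0" using \<delta> \<open>e > 0\<close> M by (simp add: \<delta>'_def)
        fix Y :: "(real ^ 'n) \<times> real" assume Y: "Y \<in> {X. snd X \<ge> 0}" "dist Y X < \<delta>'"
        obtain y z where yz: "Y = (y, z)" by fastforce
        have z: "z \<ge> 0" "z < \<delta>'" and y: "dist y (fst X) < \<delta>'"
          using Y dist_snd_le[of Y X] dist_fst_le[of Y X] 2 by (auto simp: yz dist_real_def)
        have "norm y \<le> norm (fst X) + 1"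
          using y norm_triangle_sub[of y "fst X"] by (auto simp: \<delta>'_def dist_norm)
        then have a: "e1 * norm y \<le> e / 4"
          using mult_left_mono[of "norm y" "norm (fst X) + 1" e1] e1 by simp
        have "M * z \<le> (M + 1) * (e / (4 * (M + 1)))"
          using M z by (intro mult_mono) (auto simp: \<delta>'_def)
        also have "\<dots> = e / 4" using M by (simp add: field_simps)
        finally have b: "M * z \<le> e / 4" .
        have "\<bar>conic_extension v u Y - v y\<bar> \<le> e1 * norm y + M * z"
        proof (cases "z = 0")
          case False
          then have "z > 0" using z by simp
          then have "v y = z * v (y /\<^sub>R z)" using hom[of z "y /\<^sub>R z"] by simp
          then have "\<bar>conic_extension v u Y - v y\<bar> = z * \<bar>u (y /\<^sub>R z) - v (y /\<^sub>R z)\<bar>"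
            using \<open>z > 0\<close> by (simp add: conic_extension_def yz right_diff_distrib[symmetric] abs_mult)
          also have "\<dots> \<le> z * (e1 * norm (y /\<^sub>R z) + M)"
            using \<open>z > 0\<close> M(2)[of "y /\<^sub>R z"] by (intro mult_left_mono) auto
          also have "\<dots> = e1 * norm y + M * z"
            using \<open>z > 0\<close> by (simp add: field_simps)
          finally show ?thesis .
        qed (use e1 in \<open>simp add: conic_extension_def yz\<close>)
        moreover have "\<bar>v y - v (fst X)\<bar> < e / 2"
          using \<delta>(2)[of y] y by (auto simp: \<delta>'_def dist_real_def)
        moreover have "conic_extension v u X = v (fst X)"
          using 2 by (simp add: conic_extension_def)
        ultimately show "dist (conic_extension v u Y) (conic_extension v u X) < e"
          using a b unfolding dist_real_def by linarith
      qed
    qed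
  qed
qed


lemma conic_extension_scale:
  assumes hom: "\<And>s x. s > 0 \<Longrightarrow> v (s *\<^sub>R x) = s * v x" and "s > 0"
  shows "conic_extension v u (s *\<^sub>R X) = s * conic_extension v u X"
  using assms by (auto simp: conic_extension_def field_simps)

section \<open>A maximum principle on the half-ball\<close>

text \<open>At an interior minimum all pure second derivatives are nonnegative, hence so is the
  Laplacian. But the sources \<open>2 * c / z\<close> cancel because \<open>p + q = 1\<close>, and
  the barrier leaves the Laplacian \<open>- 2 * \<epsilon>\<close>.\<close>

lemma weighted_perspective_no_interior_min:
  fixes u :: "real ^ 'n \<Rightarrow> real" and x :: "real ^ 'n"
  defines "d \<equiv> real CARD('n)"
  assumes u: "C_k 2 u"
    and pde: "\<And>x. 1 / 2 * (\<Sum>i\<in>UNIV. \<Sum>j\<in>UNIV.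
           ((if i = j then 1 else 0) + x $ i * x $ j) * partial_deriv i (partial_deriv j u) x) = c"
    and pq: "p + q = 1" and "\<epsilon> > 0" "z > 0" "\<delta> > 0" "\<delta> \<le> z"
    and \<Phi>: "\<Phi> = (\<lambda>x z. p * (z * u ((x + a) /\<^sub>R z)) + q * (z * u ((x + b) /\<^sub>R z)) - z * u (x /\<^sub>R z)
        + \<epsilon> * ((norm x)\<^sup>2 - (d + 1) * z\<^sup>2 + (d + 2) * z))"
    and min: "\<And>y s. dist (y, s) (x, z) < \<delta> \<Longrightarrow> \<Phi> x z \<le> \<Phi> y s"
  shows False
proof -
  have u1: "C_k (Suc 1) u" and u2: "C_k (Suc 0) (partial_deriv j u)" for j
    using u by (simp_all add: numeral_2_eq_2)
  define D where "D i j y = partial_deriv i (partial_deriv j u) (y /\<^sub>R z)" for i j y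
  \<comment> \<open>\<open>D i i y / z\<close> and \<open>H y / z\<close> are the horizontal and
    vertical second derivatives of the perspective at \<open>(y, z)\<close>; \<open>lap\<close>
    below is the equation at \<open>y / z\<close>.\<close>
  define H where "H y = (\<Sum>j\<in>UNIV. y $ j / z * (\<Sum>i\<in>UNIV. y $ i / z * D i j y))" for y
  have lap: "(\<Sum>i\<in>UNIV. D i i y) = 2 * c - H y" for y
  proof -
    have "(\<Sum>i\<in>UNIV. \<Sum>j\<in>UNIV.
        ((if i = j then 1 else 0) + (y /\<^sub>R z) $ i * (y /\<^sub>R z) $ j) * D i j y) = 2 * c"
      using pde[of "y /\<^sub>R z"] by (simp add: D_def)
    then show ?thesis
      unfolding sum_delta_plus_rank_one H_def by (simp add: divide_inverse mult.commute eq_diff_eq)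
  qed
  have comb: "((\<lambda>t. p * f1 t + q * f2 t - f3 t + \<epsilon> * f4 t) has_real_derivative
      p * l1 + q * l2 - l3 + \<epsilon> * l4) (at t)"
    if "(f1 has_real_derivative l1) (at t)" "(f2 has_real_derivative l2) (at t)"
      "(f3 has_real_derivative l3) (at t)" "(f4 has_real_derivative l4) (at t)"
    for f1 f2 f3 f4 l1 l2 l3 l4 t
    using that by (intro DERIV_add DERIV_diff DERIV_cmult)
  \<comment> \<open>Second derivative test for \<open>\<Phi>\<close> along a horizontal axis,
    multiplied by \<open>z\<close>.\<close>
  have axis_dir: "p * D i i (x + a) + q * D i i (x + b) - D i i x + z * (2 * \<epsilon>) \<ge> 0" for i
  proof -
    have P: "((\<lambda>t. z * u ((y + t *\<^sub>R axis i 1) /\<^sub>R z)) has_real_derivative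
        partial_deriv i u ((y + t *\<^sub>R axis i 1) /\<^sub>R z)) (at t)" for y t
      by (rule perspective_deriv_axis[OF u1 \<open>z > 0\<close>])
    have "((\<lambda>t. z * partial_deriv i u ((y + t *\<^sub>R axis i 1) /\<^sub>R z) / z) has_real_derivative
        D i i (y + 0 *\<^sub>R axis i 1) / z) (at 0)" for y
      unfolding D_def by (intro DERIV_cdivide perspective_deriv_axis[OF u2 \<open>z > 0\<close>])
    then have PP: "((\<lambda>t. partial_deriv i u ((y + t *\<^sub>R axis i 1) /\<^sub>R z)) has_real_derivative
        D i i y / z) (at 0)" for y
      using \<open>z > 0\<close> by simp
    let ?f = "\<lambda>t. \<Phi> (x + t *\<^sub>R axis i 1) z"
    have f: "?f = (\<lambda>t. p * (z * u ((x + a + t *\<^sub>R axis i 1) /\<^sub>R z))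
        + q * (z * u ((x + b + t *\<^sub>R axis i 1) /\<^sub>R z)) - z * u ((x + t *\<^sub>R axis i 1) /\<^sub>R z)
        + \<epsilon> * ((norm x)\<^sup>2 + 2 * t * x $ i + t\<^sup>2 - (d + 1) * z\<^sup>2 + (d + 2) * z))"
    proof -
      have "(norm (x + t *\<^sub>R axis i 1))\<^sup>2 = (norm x)\<^sup>2 + 2 * t * x $ i + t\<^sup>2" for t
        unfolding power2_norm_eq_inner
        by (simp add: inner_add_left inner_add_right inner_axis inner_axis' axis_nth_if power2_eq_square distrib_left)
      then show ?thesis
        unfolding \<Phi> by (simp add: ac_simps)
    qed
    have "p * (D i i (x + a) / z) + q * (D i i (x + b) / z) - D i i x / z + \<epsilon> * 2 \<ge> 0"
    proof (rule second_derivative_nonneg_at_local_min[OF \<open>\<delta> > 0\<close>, of 0 ?f])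
      fix t :: real assume t: "\<bar>t - 0\<bar> < \<delta>"
      show "?f 0 \<le> ?f t"
        using min[of "x + t *\<^sub>R axis i 1" z] t by (simp add: dist_Pair_Pair dist_norm)
      show "(?f has_real_derivative p * partial_deriv i u ((x + a + t *\<^sub>R axis i 1) /\<^sub>R z)
          + q * partial_deriv i u ((x + b + t *\<^sub>R axis i 1) /\<^sub>R z)
          - partial_deriv i u ((x + t *\<^sub>R axis i 1) /\<^sub>R z) + \<epsilon> * (2 * x $ i + 2 * t)) (at t)"
        unfolding f
        by (rule comb[OF P P P]) (auto intro!: derivative_eq_intros)
    next
      show "((\<lambda>t. p * partial_deriv i u ((x + a + t *\<^sub>R axis i 1) /\<^sub>R z)
          + q * partial_deriv i u ((x + b + t *\<^sub>R axis i 1) /\<^sub>R z)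
          - partial_deriv i u ((x + t *\<^sub>R axis i 1) /\<^sub>R z) + \<epsilon> * (2 * x $ i + 2 * t)) has_real_derivative
          p * (D i i (x + a) / z) + q * (D i i (x + b) / z) - D i i x / z + \<epsilon> * 2) (at 0)"
        by (rule comb[OF PP PP PP]) (auto intro!: derivative_eq_intros)
    qed
    also have "p * (D i i (x + a) / z) + q * (D i i (x + b) / z) - D i i x / z + \<epsilon> * 2
        = (p * D i i (x + a) + q * D i i (x + b) - D i i x + z * (2 * \<epsilon>)) / z"
      using \<open>z > 0\<close> by (simp add: field_simps)
    finally show ?thesis
      using \<open>z > 0\<close> by (simp add: zero_le_divide_iff)
  qed
  have height_dir: "p * H (x + a) + q * H (x + b) - H x - z * (2 * \<epsilon> * (d + 1)) \<ge> 0"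
  proof -
    define G where "G y s = u (y /\<^sub>R s) - (\<Sum>j\<in>UNIV. y $ j / s * partial_deriv j u (y /\<^sub>R s))" for y s
    have P: "((\<lambda>s. s * u (y /\<^sub>R s)) has_real_derivative G y s) (at s)" if "s > 0" for y s
      unfolding G_def by (rule perspective_deriv_height[OF u1 that])
    have PP: "(G y has_real_derivative H y / z) (at z)" for y
      unfolding G_def[abs_def] H_def D_def by (rule perspective_deriv2_height[OF u \<open>z > 0\<close>])
    have "p * (H (x + a) / z) + q * (H (x + b) / z) - H x / z + \<epsilon> * (- (2 * (d + 1))) \<ge> 0"
    proof (rule second_derivative_nonneg_at_local_min[OF \<open>\<delta> > 0\<close>, of z "\<Phi> x"])
      fix s assume s: "\<bar>s - z\<bar> < \<delta>"
      show "\<Phi> x z \<le> \<Phi> x s"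
        using min[of x s] s by (simp add: dist_Pair_Pair dist_real_def)
      \<comment> \<open>The condition \<open>\<delta> \<le> z\<close> keeps the vertical segment
        inside the open half-space.\<close>
      have "s > 0" using s \<open>\<delta> \<le> z\<close> by linarith
      show "(\<Phi> x has_real_derivative p * G (x + a) s + q * G (x + b) s - G x s
          + \<epsilon> * ((d + 2) - 2 * (d + 1) * s)) (at s)"
        unfolding \<Phi>
        by (rule comb[OF P[OF \<open>s > 0\<close>] P[OF \<open>s > 0\<close>] P[OF \<open>s > 0\<close>]]) (auto intro!: derivative_eq_intros)
    next
      show "((\<lambda>s. p * G (x + a) s + q * G (x + b) s - G x s
          + \<epsilon> * ((d + 2) - 2 * (d + 1) * s)) has_real_derivative
          p * (H (x + a) / z) + q * (H (x + b) / z) - H x / z + \<epsilon> * (- (2 * (d + 1)))) (at z)"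
        by (rule comb[OF PP PP PP]) (auto intro!: derivative_eq_intros)
    qed
    also have "p * (H (x + a) / z) + q * (H (x + b) / z) - H x / z + \<epsilon> * (- (2 * (d + 1)))
        = (p * H (x + a) + q * H (x + b) - H x - z * (2 * \<epsilon> * (d + 1))) / z"
      using \<open>z > 0\<close> by (simp add: field_simps)
    finally show ?thesis
      using \<open>z > 0\<close> by (simp add: zero_le_divide_iff)
  qed
  \<comment> \<open>Summing over the axes, \<open>lap\<close> trades the horizontal terms for
    \<open>2 * c\<close> and \<open>H\<close>. The vertical inequality then removes
    \<open>H\<close>, leaving \<open>2 * \<epsilon> * z * (d - (d + 1))\<close>.\<close>
  have "0 \<le> (\<Sum>i\<in>UNIV. p * D i i (x + a) + q * D i i (x + b) - D i i x + z * (2 * \<epsilon>))"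
    using axis_dir by (intro sum_nonneg) auto
  also have "\<dots> = p * (\<Sum>i\<in>UNIV. D i i (x + a)) + q * (\<Sum>i\<in>UNIV. D i i (x + b))
      - (\<Sum>i\<in>UNIV. D i i x) + z * (2 * \<epsilon>) * d"
    by (simp add: sum.distrib sum_subtractf sum_distrib_left d_def)
  also have "\<dots> = p * (2 * c - H (x + a)) + q * (2 * c - H (x + b))
      - (2 * c - H x) + z * (2 * \<epsilon>) * d"
    by (simp only: lap)
  also have "\<dots> = (p + q - 1) * (2 * c) - (p * H (x + a) + q * H (x + b) - H x - z * (2 * \<epsilon> * (d + 1)))
      - z * (2 * \<epsilon>)"
    by (simp add: algebra_simps)
  also have "\<dots> \<le> - (z * (2 * \<epsilon>))"
    using height_dir pq by simp
  finally show False
    using \<open>z > 0\<close> \<open>\<epsilon> > 0\<close> by (simp add: mult_le_0_iff)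
qed

text \<open>The barrier \<open>(norm x)\<^sup>2 - (d + 1) * z\<^sup>2 + (d + 2) * z\<close> has Laplacian \<open>-2\<close>, is nonnegative on
  \<open>z = 0\<close> and at least \<open>1\<close> on the unit half-sphere, and is \<open>O(1 / R)\<close> at \<open>(x, 1) / R\<close>. That
  last property makes it beat the \<open>o(R)\<close> growth of the convexity defect after rescaling.\<close>

lemma half_ball_lower_bound:
  fixes u v :: "real ^ 'n \<Rightarrow> real"
  defines "d \<equiv> real CARD('n)" and "F \<equiv> conic_extension v u"
  assumes u: "C_k 2 u"
    and pde: "\<And>x. 1 / 2 * (\<Sum>i\<in>UNIV. \<Sum>j\<in>UNIV.
           ((if i = j then 1 else 0) + x $ i * x $ j) * partial_deriv i (partial_deriv j u) x) = c"
    and F: "continuous_on {X. snd X \<ge> 0} F"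
    and pq: "p \<ge> 0" "q \<ge> 0" "p + q = 1" and "\<epsilon> > 0"
    and bdry: "\<And>x. v x \<le> p * v (x + a) + q * v (x + b)"
    and a: "\<And>X. norm X \<le> 1 \<Longrightarrow> snd X \<ge> 0 \<Longrightarrow> \<bar>F (fst X + a, snd X) - F X\<bar> \<le> \<epsilon>"
    and b: "\<And>X. norm X \<le> 1 \<Longrightarrow> snd X \<ge> 0 \<Longrightarrow> \<bar>F (fst X + b, snd X) - F X\<bar> \<le> \<epsilon>"
    and X: "norm X \<le> 1" "snd X \<ge> 0"
  shows "p * F (fst X + a, snd X) + q * F (fst X + b, snd X) - F X
      \<ge> - (\<epsilon> * ((norm (fst X))\<^sup>2 - (d + 1) * (snd X)\<^sup>2 + (d + 2) * snd X))"
proof (rule ccontr)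
  assume neg: "\<not> ?thesis"
  let ?K = "{X :: (real ^ 'n) \<times> real. norm X \<le> 1 \<and> snd X \<ge> 0}"
  \<comment> \<open>\<open>\<Psi>\<close> is the defect plus the barrier. Its minimum over the
    compact half-ball would be negative; the flat face and the spherical cap are excluded in turn,
    which leaves the interior.\<close>
  define \<Psi> where "\<Psi> X = p * F (fst X + a, snd X) + q * F (fst X + b, snd X) - F X
      + \<epsilon> * ((norm (fst X))\<^sup>2 - (d + 1) * (snd X)\<^sup>2 + (d + 2) * snd X)" for X
  have "?K = cball 0 1 \<inter> {X. snd X \<ge> 0}" by auto
  moreover have "closed {X :: (real ^ 'n) \<times> real. snd X \<ge> 0}"
    by (intro closed_Collect_le continuous_intros)
  ultimately have "compact ?K" by (simp add: compact_Int_closed)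
  moreover have "continuous_on ?K \<Psi>"
    unfolding \<Psi>_def by (intro continuous_intros continuous_on_compose2[OF F]) auto
  ultimately obtain M where M: "M \<in> ?K" "\<And>Y. Y \<in> ?K \<Longrightarrow> \<Psi> M \<le> \<Psi> Y"
    using continuous_attains_inf[of ?K \<Psi>] X by blast
  obtain x z where xz: "M = (x, z)" by fastforce
  have "\<Psi> X < 0" using neg by (simp add: \<Psi>_def not_le)
  then have neg: "\<Psi> (x, z) < 0" using M(2)[of X] X xz by auto
  have z: "z \<ge> 0" and n: "norm (x, z) \<le> 1" using M(1) xz by auto
  have "z \<noteq> 0"
  proof
    assume "z = 0"
    then have "\<Psi> (x, z) = p * v (x + a) + q * v (x + b) - v x + \<epsilon> * (norm x)\<^sup>2"
      by (simp add: \<Psi>_def F_def conic_extension_def)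
    then show False using neg bdry[of x] \<open>\<epsilon> > 0\<close> by (smt (verit) mult_nonneg_nonneg zero_le_power2)
  qed
  then have z: "z > 0" using z by simp
  have "norm (x, z) \<noteq> 1"
  proof
    assume n1: "norm (x, z) = 1"
    \<comment> \<open>On the cap the barrier equals \<open>1 + (d + 2) * (z - z^2) \<ge> 1\<close>,
      so it contributes at least \<open>\<epsilon>\<close>, which absorbs the loss of at most
      \<open>(p + q) * \<epsilon>\<close> from the displacements.\<close>
    then have "(norm x)\<^sup>2 + z\<^sup>2 = 1" by (simp add: norm_Pair)
    moreover have "z * z \<le> 1 * z"
      using n1 z norm_snd_le[of z x] by (intro mult_right_mono) auto
    then have "(d + 2) * z\<^sup>2 \<le> (d + 2) * z"
      by (intro mult_left_mono) (auto simp: power2_eq_square d_def)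
    ultimately have "(norm x)\<^sup>2 - (d + 1) * z\<^sup>2 + (d + 2) * z \<ge> 1"
      by (simp add: algebra_simps)
    then have "\<epsilon> * ((norm x)\<^sup>2 - (d + 1) * z\<^sup>2 + (d + 2) * z) \<ge> \<epsilon>"
      using \<open>\<epsilon> > 0\<close> by simp
    moreover have "p * (F (x + a, z) - F (x, z)) \<ge> p * (- \<epsilon>)"
        and "q * (F (x + b, z) - F (x, z)) \<ge> q * (- \<epsilon>)"
      using a[of "(x, z)"] b[of "(x, z)"] n z pq by (intro mult_left_mono; fastforce)+
    then have "p * F (x + a, z) + q * F (x + b, z) - (p + q) * F (x, z) \<ge> - ((p + q) * \<epsilon>)"
      by (simp add: algebra_simps)
    ultimately show False using neg pq(3) by (simp add: \<Psi>_def)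
  qed
  then have n: "norm (x, z) < 1" using n by simp
  define \<delta> where "\<delta> = min z (1 - norm (x, z))"
  have \<delta>: "\<delta> > 0" "\<delta> \<le> z" using n z by (auto simp: \<delta>_def)
  define \<Phi> where "\<Phi> = (\<lambda>x z. p * (z * u ((x + a) /\<^sub>R z)) + q * (z * u ((x + b) /\<^sub>R z)) - z * u (x /\<^sub>R z)
        + \<epsilon> * ((norm x)\<^sup>2 - (d + 1) * z\<^sup>2 + (d + 2) * z))"
  have \<Psi>\<Phi>: "\<Psi> (y, s) = \<Phi> y s" if "s > 0" for y s
    using that by (simp add: \<Psi>_def \<Phi>_def F_def conic_extension_def)
  show False
  proof (rule weighted_perspective_no_interior_min[OF u pde pq(3) \<open>\<epsilon> > 0\<close> z \<delta>, of \<Phi> a b])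
    fix y s assume *: "dist (y, s) (x, z) < \<delta>"
    have "s > 0"
      using * dist_snd_le[of "(y, s)" "(x, z)"] \<delta>(2) by (simp add: dist_real_def)
    moreover have "norm (y, s) \<le> 1"
      using * norm_triangle_sub[of "(y, s)" "(x, z)"] unfolding \<delta>_def dist_norm by linarith
    ultimately show "\<Phi> x z \<le> \<Phi> y s"
      using M(2)[of "(y, s)"] z by (simp add: xz \<Psi>\<Phi>)
  qed (simp add: \<Phi>_def d_def)
qed

section \<open>Convexity at height one and at height zero\<close>

text \<open>Scaling by \<open>1 / R\<close> brings \<open>(x, 1)\<close> into the unit half-ball and
  shrinks the displacements until uniform continuity of \<open>F\<close> makes their effect at most
  \<open>\<epsilon>\<close>. The half-ball bound is then \<open>O(\<epsilon> / R)\<close>, and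
  homogeneity cancels \<open>R\<close> before \<open>\<epsilon>\<close> tends to zero.\<close>

lemma convex_on_of_convex_on_boundary:
  fixes u v :: "real ^ 'n \<Rightarrow> real"
  assumes u: "C_k 2 u"
    and pde: "\<And>x. 1 / 2 * (\<Sum>i\<in>UNIV. \<Sum>j\<in>UNIV.
           ((if i = j then 1 else 0) + x $ i * x $ j) * partial_deriv i (partial_deriv j u) x) = c"
    and F: "continuous_on {X. snd X \<ge> 0} (conic_extension v u)"
    and hom: "\<And>s x. s > 0 \<Longrightarrow> v (s *\<^sub>R x) = s * v x"
    and v: "convex_on UNIV v"
  shows "convex_on UNIV u"
proof (intro convex_onI)
  fix t :: real and x1 x2 :: "real ^ 'n" assume t: "0 < t" "t < 1"
  let ?F = "conic_extension v u"
  define d where "d = real CARD('n)"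
  define x where "x = (1 - t) *\<^sub>R x1 + t *\<^sub>R x2"
  \<comment> \<open>Displacements from \<open>x\<close> to the endpoints, with
    \<open>(1 - t) *\<^sub>R a + t *\<^sub>R b = 0\<close>, so that convexity of \<open>v\<close>
    gives the boundary inequality at every base point.\<close>
  define a b where "a = t *\<^sub>R (x1 - x2)" and "b = (1 - t) *\<^sub>R (x2 - x1)"
  have xab: "x + a = x1" "x + b = x2"
    by (simp_all add: x_def a_def b_def algebra_simps)
  define W where "W = (1 - t) * u x1 + t * u x2 - u x"
  \<comment> \<open>Bounds \<open>R\<close> times the barrier at \<open>(x, 1) / R\<close> for all
    \<open>R \<ge> 1\<close>, and depends on neither \<open>R\<close> nor
    \<open>\<epsilon>\<close>.\<close>
  define C where "C = (norm x)\<^sup>2 + d + 2"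
  have "C > 0" by (simp add: C_def d_def add_nonneg_pos)
  have bound: "W \<ge> - (\<epsilon> * C)" if "\<epsilon> > 0" for \<epsilon>
  proof -
    \<comment> \<open>Radius 2 leaves room for displacements of length at most one from the unit
      half-ball.\<close>
    let ?K = "{X :: (real ^ 'n) \<times> real. norm X \<le> 2 \<and> snd X \<ge> 0}"
    have "?K = cball 0 2 \<inter> {X. snd X \<ge> 0}" by auto
    moreover have "closed {X :: (real ^ 'n) \<times> real. snd X \<ge> 0}"
      by (intro closed_Collect_le continuous_intros)
    ultimately have "compact ?K" by (simp add: compact_Int_closed)
    moreover have "continuous_on ?K ?F"
      by (rule continuous_on_subset[OF F]) auto
    ultimately have "uniformly_continuous_on ?K ?F"
      by (intro compact_uniformly_continuous)
    from uniformly_continuous_onE[OF this \<open>\<epsilon> > 0\<close>]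
    obtain \<delta> where \<delta>: "\<delta> > 0"
        "\<And>X Y. X \<in> ?K \<Longrightarrow> Y \<in> ?K \<Longrightarrow> dist Y X < \<delta> \<Longrightarrow> dist (?F Y) (?F X) < \<epsilon>"
      by blast
    \<comment> \<open>Large enough for \<open>R \<ge> 1\<close>, for \<open>(x, 1) / R\<close> to
      lie in the unit ball, and for the rescaled displacements to be shorter than both
      \<open>1\<close> and \<open>\<delta>\<close>.\<close>
    define R where "R = 1 + norm (x, 1 :: real) + (1 + 1 / \<delta>) * (norm a + norm b)"
    have nn: "(1 + 1 / \<delta>) * (norm a + norm b) \<ge> 0" using \<delta>(1) by simp
    have R: "R \<ge> 1" "norm (x, 1 :: real) \<le> R" using nn by (auto simp: R_def)
    have small: "norm (h /\<^sub>R R) < \<delta>" "norm (h /\<^sub>R R) \<le> 1" if "norm h \<le> norm a + norm b" for h :: "real ^ 'n"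
    proof -
      have "R > norm h + norm h / \<delta>"
        using \<delta>(1) mult_left_mono[OF that, of "1 + 1 / \<delta>"] norm_ge_zero[of "(x, 1 :: real)"]
        unfolding R_def distrib_right by (simp del: norm_ge_zero)
      then have "R > norm h / \<delta>" "R > norm h"
        using \<delta>(1) norm_ge_zero[of h] by (smt (verit) divide_nonneg_pos)+
      then show "norm (h /\<^sub>R R) < \<delta>" "norm (h /\<^sub>R R) \<le> 1"
        using \<delta>(1) R(1) by (auto simp: field_simps)
    qed
    have move: "\<bar>?F (fst X + h /\<^sub>R R, snd X) - ?F X\<bar> \<le> \<epsilon>"
      if "norm X \<le> 1" "snd X \<ge> 0" "norm h \<le> norm a + norm b" for h X
    proof -
      have eq: "(fst X + h /\<^sub>R R, snd X) = X + (h /\<^sub>R R, 0)" by (simp add: prod_eq_iff)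
      have nh: "norm (h /\<^sub>R R, 0 :: real) = norm (h /\<^sub>R R)" by (simp add: norm_Pair)
      have "norm (fst X + h /\<^sub>R R, snd X) \<le> 2"
        unfolding eq using that small(2)[of h] norm_triangle_ineq[of X "(h /\<^sub>R R, 0)"] nh by linarith
      moreover have "dist (fst X + h /\<^sub>R R, snd X) X < \<delta>"
        unfolding eq dist_norm using small(1)[of h] that nh by simp
      ultimately show ?thesis
        using \<delta>(2)[of X "(fst X + h /\<^sub>R R, snd X)"] that by (simp add: dist_real_def)
    qed
    have "v y \<le> (1 - t) * v (y + a /\<^sub>R R) + t * v (y + b /\<^sub>R R)" for y
    proof -
      have "(1 - t) *\<^sub>R (y + a /\<^sub>R R) + t *\<^sub>R (y + b /\<^sub>R R) = y"
        by (simp add: a_def b_def algebra_simps)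
      then show ?thesis
        using convex_onD[OF v, of t "y + a /\<^sub>R R" "y + b /\<^sub>R R"] t by simp
    qed
    moreover have "norm ((x, 1 :: real) /\<^sub>R R) \<le> 1"
      unfolding norm_scaleR using R by (simp add: field_simps)
    ultimately
    have *: "(1 - t) * ?F (x /\<^sub>R R + a /\<^sub>R R, 1 / R) + t * ?F (x /\<^sub>R R + b /\<^sub>R R, 1 / R) - ?F (x /\<^sub>R R, 1 / R)
      \<ge> - (\<epsilon> * ((norm (x /\<^sub>R R))\<^sup>2 - (d + 1) * (1 / R)\<^sup>2 + (d + 2) * (1 / R)))"
      using half_ball_lower_bound[OF u pde F _ _ _ \<open>\<epsilon> > 0\<close>, of "1 - t" t "a /\<^sub>R R" "b /\<^sub>R R" "(x, 1) /\<^sub>R R"]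
        t move[of _ a] move[of _ b] R by (simp add: d_def divide_inverse)
    have sc: "?F (x /\<^sub>R R + h /\<^sub>R R, 1 / R) = u (x + h) / R" for h
      using R(1) by (simp add: conic_extension_def scaleR_add_right)
    have "(norm (x /\<^sub>R R))\<^sup>2 - (d + 1) * (1 / R)\<^sup>2 + (d + 2) * (1 / R) \<le> C / R"
    proof -
      have "(norm x)\<^sup>2 / R\<^sup>2 \<le> (norm x)\<^sup>2 / R"
        using R(1) by (intro divide_left_mono) (auto simp: power2_eq_square)
      moreover have "(norm (x /\<^sub>R R))\<^sup>2 = (norm x)\<^sup>2 / R\<^sup>2"
        using R(1) by (simp add: power_divide divide_inverse power_mult_distrib power_inverse mult.commute)
      moreover have "(d + 1) * (1 / R)\<^sup>2 \<ge> 0" by (simp add: d_def)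
      moreover have "C / R = (norm x)\<^sup>2 / R + (d + 2) * (1 / R)"
        by (simp add: C_def add_divide_distrib)
      ultimately show ?thesis by linarith
    qed
    then have "\<epsilon> * ((norm (x /\<^sub>R R))\<^sup>2 - (d + 1) * (1 / R)\<^sup>2 + (d + 2) * (1 / R)) \<le> \<epsilon> * (C / R)"
      using \<open>\<epsilon> > 0\<close> by (intro mult_left_mono) auto
    with * sc[of a] sc[of b] sc[of 0] have "W / R \<ge> - (\<epsilon> * C) / R"
      by (simp add: W_def xab diff_divide_distrib add_divide_distrib)
    then show ?thesis using R(1) unfolding divide_le_cancel by simp
  qed
  have "W \<ge> 0"
  proof (rule ccontr)
    assume "\<not> W \<ge> 0"
    \<comment> \<open>This choice of \<open>\<epsilon>\<close> turns the bound into
      \<open>W \<ge> W / 2\<close>, impossible for negative \<open>W\<close>.\<close>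
    then show False
      using bound[of "- W / (2 * C)"] \<open>C > 0\<close> by (simp add: field_simps)
  qed
  then show "u ((1 - t) *\<^sub>R x1 + t *\<^sub>R x2) \<le> (1 - t) * u x1 + t * u x2"
    by (simp add: W_def x_def)
qed simp

text \<open>At each fixed positive height the perspective is a rescaled copy of \<open>u\<close>,
  hence convex, and it tends pointwise to \<open>v\<close> as the height tends to zero.\<close>

lemma convex_on_boundary_of_convex_on:
  fixes u v :: "real ^ 'n \<Rightarrow> real"
  assumes F: "continuous_on {X. snd X \<ge> 0} (conic_extension v u)"
    and u: "convex_on UNIV u"
  shows "convex_on UNIV v"
proof (intro convex_onI)
  fix t :: real and x y :: "real ^ 'n" assume t: "0 < t" "t < 1"
  let ?F = "conic_extension v u"
  have lim: "(\<lambda>n. ?F (x, 1 / real (Suc n))) \<longlonglongrightarrow> v x" for x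
  proof -
    have "(\<lambda>n. (x, 1 / real (Suc n))) \<longlonglongrightarrow> (x, 0)"
      by (intro tendsto_intros LIMSEQ_Suc lim_1_over_n)
    from continuous_on_tendsto_compose[OF F this] show ?thesis
      by (simp add: conic_extension_def del: of_nat_Suc)
  qed
  show "v ((1 - t) *\<^sub>R x + t *\<^sub>R y) \<le> (1 - t) * v x + t * v y"
  proof (rule LIMSEQ_le[OF lim], rule tendsto_add[OF tendsto_mult[OF tendsto_const lim] tendsto_mult[OF tendsto_const lim]])
    have "?F ((1 - t) *\<^sub>R x + t *\<^sub>R y, s) \<le> (1 - t) * ?F (x, s) + t * ?F (y, s)" if "s > 0" for s
    proof -
      have "u (((1 - t) *\<^sub>R x + t *\<^sub>R y) /\<^sub>R s) = u ((1 - t) *\<^sub>R (x /\<^sub>R s) + t *\<^sub>R (y /\<^sub>R s))"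
        by (simp add: scaleR_add_right mult.commute)
      also have "\<dots> \<le> (1 - t) * u (x /\<^sub>R s) + t * u (y /\<^sub>R s)"
        using convex_onD[OF u, of t "x /\<^sub>R s" "y /\<^sub>R s"] t by simp
      finally have "s * u (((1 - t) *\<^sub>R x + t *\<^sub>R y) /\<^sub>R s)
          \<le> s * ((1 - t) * u (x /\<^sub>R s) + t * u (y /\<^sub>R s))"
        using that by (intro mult_left_mono) auto
      then show ?thesis
        using that by (simp add: conic_extension_def distrib_left mult.left_commute)
    qed
    then show "\<exists>N. \<forall>n\<ge>N. ?F ((1 - t) *\<^sub>R x + t *\<^sub>R y, 1 / real (Suc n))
        \<le> (1 - t) * ?F (x, 1 / real (Suc n)) + t * ?F (y, 1 / real (Suc n))"
      by simp
  qed
qed simp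

section \<open>Continuity and growth estimates for the boundary values\<close>

text \<open>At the origin, compactness of the sphere gives a bound \<open>B\<close> for
  \<open>g\<close>, and the extension is at most \<open>B * norm y\<close> in absolute
  value.\<close>

lemma continuous_on_homogeneous_extension:
  fixes g :: "real ^ 'n \<Rightarrow> real"
  assumes g: "continuous_on (sphere 0 1) g"
  shows "continuous_on UNIV (homogeneous_extension g)"
proof -
  have "compact (g ` sphere 0 1)"
    using g by (intro compact_continuous_image) auto
  then obtain B where B: "\<And>\<theta>. norm \<theta> = 1 \<Longrightarrow> \<bar>g \<theta>\<bar> \<le> B"
    using compact_imp_bounded[of "g ` sphere 0 1"] unfolding bounded_iff by fastforce
  have "isCont (homogeneous_extension g) x" for x
  proof (cases "x = 0")
    case True
    have "\<bar>homogeneous_extension g y\<bar> \<le> B * norm y" for y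
      using B[of "y /\<^sub>R norm y"]
      by (auto simp: homogeneous_extension_def abs_mult mult.commute[of B] intro!: mult_left_mono)
    moreover have "((\<lambda>y :: real ^ 'n. B * norm y) \<longlongrightarrow> 0) (at 0)"
      by (auto intro!: tendsto_eq_intros)
    ultimately have "(homogeneous_extension g \<longlongrightarrow> 0) (at 0)"
      by (auto intro: Lim_null_comparison[where g = "\<lambda>y. B * norm y"])
    then show ?thesis using True by (simp add: isCont_def homogeneous_extension_def)
  next
    case False
    have "continuous_on (- {0}) (\<lambda>x. norm x * g (x /\<^sub>R norm x))"
      by (intro continuous_intros continuous_on_compose2[OF g])
        (auto, metis left_inverse norm_eq_zero)
    then have "continuous_on (- {0}) (homogeneous_extension g)"
      by (rule continuous_on_eq) (auto simp: homogeneous_extension_def)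
    then show ?thesis
      using False by (simp add: continuous_on_eq_continuous_at open_Compl)
  qed
  then show ?thesis by (simp add: continuous_on_eq_continuous_at)
qed

lemma homogeneous_extension_scale:
  "s > 0 \<Longrightarrow> homogeneous_extension g (s *\<^sub>R x) = s * homogeneous_extension g x"
  by (simp add: homogeneous_extension_def field_simps)

text \<open>Outside a large ball the limit, multiplied by \<open>norm y\<close>, gives the linear
  term; inside it the continuous difference is bounded. A linear error of arbitrarily small slope is
  what the rescaling in \<open>conic_extension\<close> can absorb.\<close>

lemma asymptotic_bound:
  fixes g u :: "real ^ 'n \<Rightarrow> real"
  assumes g: "continuous_on (sphere 0 1) g" and u: "continuous_on UNIV u"
    and lim: "((\<lambda>r. SUP \<theta>\<in>sphere 0 1. \<bar>u (r *\<^sub>R \<theta>) / r - g \<theta>\<bar>) \<longlongrightarrow> 0) at_top"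
    and "e > 0"
  shows "\<exists>M\<ge>0. \<forall>y. \<bar>u y - homogeneous_extension g y\<bar> \<le> e * norm y + M"
proof -
  let ?v = "homogeneous_extension g"
  obtain R0 where R0: "\<And>r. r \<ge> R0 \<Longrightarrow> (SUP \<theta>\<in>sphere 0 1. \<bar>u (r *\<^sub>R \<theta>) / r - g \<theta>\<bar>) < e"
    using order_tendstoD(2)[OF lim \<open>e > 0\<close>] unfolding eventually_at_top_linorder by auto
  define R where "R = max R0 1"
  have "compact ((\<lambda>y. u y - ?v y) ` cball 0 R)"
    using u continuous_on_homogeneous_extension[OF g]
    by (intro compact_continuous_image continuous_on_diff) (auto intro: continuous_on_subset)
  then obtain M where M: "\<And>y. norm y \<le> R \<Longrightarrow> \<bar>u y - ?v y\<bar> \<le> M"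
    using compact_imp_bounded[of "(\<lambda>y. u y - ?v y) ` cball 0 R"] unfolding bounded_iff by fastforce
  have "\<bar>u y - ?v y\<bar> \<le> e * norm y" if "norm y > R" for y
  proof -
    let ?r = "norm y" and ?\<theta> = "y /\<^sub>R norm y"
    have r: "?r > 0" using that unfolding R_def by linarith
    have "compact ((\<lambda>\<theta>. \<bar>u (?r *\<^sub>R \<theta>) / ?r - g \<theta>\<bar>) ` sphere 0 1)"
      using r by (intro compact_continuous_image continuous_intros continuous_on_compose2[OF u] g) auto
    \<comment> \<open>A real supremum bounds its members only if the set is bounded above, so this
      precedes the use of the limit at a single direction.\<close>
    then have "bdd_above ((\<lambda>\<theta>. \<bar>u (?r *\<^sub>R \<theta>) / ?r - g \<theta>\<bar>) ` sphere 0 1)"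
      by (intro bounded_imp_bdd_above compact_imp_bounded)
    then have "\<bar>u (?r *\<^sub>R ?\<theta>) / ?r - g ?\<theta>\<bar> \<le> (SUP \<theta>\<in>sphere 0 1. \<bar>u (?r *\<^sub>R \<theta>) / ?r - g \<theta>\<bar>)"
      using r by (intro cSUP_upper) auto
    also have "\<dots> \<le> e" using R0[of ?r] that by (simp add: R_def)
    finally have "?r * \<bar>u y / ?r - g ?\<theta>\<bar> \<le> ?r * e"
      using r by simp
    moreover have "?r * \<bar>u y / ?r - g ?\<theta>\<bar> = \<bar>?r * (u y / ?r - g ?\<theta>)\<bar>"
      by (simp add: abs_mult)
    moreover have "?r * (u y / ?r - g ?\<theta>) = u y - ?v y"
      using r by (simp add: homogeneous_extension_def right_diff_distrib)
    ultimately show ?thesis by (simp add: mult.commute)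
  qed
  moreover have "e * norm y \<ge> 0" for y :: "real ^ 'n" using \<open>e > 0\<close> by simp
  ultimately have "\<bar>u y - ?v y\<bar> \<le> e * norm y + max M 0" for y
    using M[of y] by (smt (verit))
  then show ?thesis by (intro exI[of _ "max M 0"]) auto
qed

theorem theorem2:
  fixes g u :: "real ^ 'n \<Rightarrow> real" and c :: real
  assumes "CARD('n) \<ge> 2"
    and "continuous_on (sphere 0 1) g"
    and "c = gamma_const CARD('n) * (\<integral>\<theta>. g \<theta> \<partial>sphere_measure)"
    and "C_k 2 u"
    and "\<And>x. 1 / 2 * (\<Sum>i\<in>UNIV. \<Sum>j\<in>UNIV.
           ((if i = j then 1 else 0) + x $ i * x $ j) * partial_deriv i (partial_deriv j u) x) = c"
    and "u 0 = 0"
    and "((\<lambda>r. SUP \<theta>\<in>sphere 0 1. \<bar>u (r *\<^sub>R \<theta>) / r - g \<theta>\<bar>) \<longlongrightarrow> 0) at_top"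
  shows "convex_on UNIV u \<longleftrightarrow> convex_on UNIV (homogeneous_extension g)"
proof -
  have u: "continuous_on UNIV u"
    by (rule C_k_continuous[OF assms(4)])
  \<comment> \<open>The growth condition enters here, as continuity of \<open>F\<close> up to height
    zero; both implications rest on it.\<close>
  have F: "continuous_on {X. snd X \<ge> 0} (conic_extension (homogeneous_extension g) u)"
    by (intro continuous_on_conic_extension u continuous_on_homogeneous_extension[OF assms(2)]
        homogeneous_extension_scale asymptotic_bound[OF assms(2) u assms(7)])
  show ?thesis
    using convex_on_boundary_of_convex_on[OF F]
      convex_on_of_convex_on_boundary[OF assms(4,5) F homogeneous_extension_scale]
    by blast
qed

end
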